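(* For $\ell\in\mathbb{N}$ let $g_\ell(n)$ denote the number of subgroups of $\mathbb{Z}^{\ell}$ of index $n$. Define $P_0^{(\ell)}(x)=1$, $P_n^{(\ell)}(x)=\frac{x}{n}\sum_{k=1}^{n}g_\ell(k)P_{n-k}^{(\ell)}(x)$ for $n\geq1$, and $\Delta_n^{(\ell)}(x)=(P_n^{(\ell)}(x))^{n+1}-(P_{n+1}^{(\ell)}(x))^{n}$. Then for $\ell\in\{3,4\}$ and all $8\leq n\leq 25$, we have $\Delta_n^{(\ell)}(x)>0$ for all real $x\geq1$. *)

theory Defs
  imports Complex_Main "HOL-Algebra.Product_Groups"
begin

text \<open>
  The elements of \<open>free_Z l\<close> are the functions from \<open>{..<l}\<close> to the integers, extended
  by \<open>undefined\<close> outside \<open>{..<l}\<close>, with pointwise addition.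
\<close>

definition free_Z :: "nat \<Rightarrow> (nat \<Rightarrow> int) monoid" where
  "free_Z l = product_group {..<l} (\<lambda>_. integer_group)"

text \<open>
  Finiteness of the coset space is required explicitly because \<open>card\<close> is \<open>0\<close> on infinite
  sets; without it the subgroups of infinite index would be counted as having index \<open>0\<close>.
\<close>

definition num_subgroups :: "nat \<Rightarrow> nat \<Rightarrow> nat" where
  "num_subgroups l n =
     card {H. subgroup H (free_Z l) \<and> finite (rcosets\<^bsub>free_Z l\<^esub> H) \<and>
              card (rcosets\<^bsub>free_Z l\<^esub> H) = n}"

fun P_poly :: "nat \<Rightarrow> nat \<Rightarrow> real \<Rightarrow> real" where
  "P_poly l 0 x = 1"
| "P_poly l (Suc n) x =
     x / real (Suc n) * (\<Sum>k = 1..Suc n. real (num_subgroups l k) * P_poly l (Suc n - k) x)"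

definition Delta :: "nat \<Rightarrow> nat \<Rightarrow> real \<Rightarrow> real" where
  "Delta l n x = P_poly l n x ^ (n + 1) - P_poly l (n + 1) x ^ n"

end

theory Submission imports Defs begin

text \<open>
  A finite-index subgroup \<open>H\<close> of \<open>G \<times> \<int>\<close> is determined by its intersection \<open>K\<close> with \<open>G\<close>, the
  positive generator \<open>d\<close> of its projection to \<open>\<int>\<close>, and the coset of \<open>K\<close> formed by the \<open>v\<close> with
  \<open>(v, d) \<in> H\<close>; its index is \<open>d\<close> times the index of \<open>K\<close>. Since \<open>K\<close> has as many cosets as its index,
  \<open>g\<^sub>l\<^sub>+\<^sub>1(n)\<close> is the sum of \<open>m g\<^sub>l(m)\<close> over the divisors \<open>m\<close> of \<open>n\<close>.

  For the inequality put \<open>x = 1 + y\<close>. For \<open>8 \<le> n \<le> 25\<close> the polynomial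
  \<open>(n + 1) P\<^sub>n' P\<^sub>n\<^sub>+\<^sub>1 - n P\<^sub>n P\<^sub>n\<^sub>+\<^sub>1'\<close> has nonnegative coefficients in \<open>y\<close>, so the quotient
  \<open>P\<^sub>n ^ (n + 1) / P\<^sub>n\<^sub>+\<^sub>1 ^ n\<close> is nondecreasing for \<open>x \<ge> 1\<close>. At \<open>x = 1\<close> it exceeds \<open>1\<close>, which is witnessed by a
  rational number strictly between the \<open>(n + 1)\<close>-th root of \<open>P\<^sub>n\<^sub>+\<^sub>1(1)\<close> and the \<open>n\<close>-th root of \<open>P\<^sub>n(1)\<close>.
\<close>

section \<open>Subgroups of finite index\<close>

definition subgroups_of_index :: "('a, 'b) monoid_scheme \<Rightarrow> nat \<Rightarrow> 'a set set" where
  "subgroups_of_index G n =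
     {H. subgroup H G \<and> finite (rcosets\<^bsub>G\<^esub> H) \<and> card (rcosets\<^bsub>G\<^esub> H) = n}"

lemma subgroups_of_index_subset: "H \<in> subgroups_of_index G n \<Longrightarrow> H \<subseteq> carrier G"
  by (auto simp: subgroups_of_index_def dest: subgroup.subset)

lemma num_subgroups_eq: "num_subgroups l n = card (subgroups_of_index (free_Z l) n)"
  by (simp add: num_subgroups_def subgroups_of_index_def)

section \<open>Coset spaces and invariance of the index under isomorphism\<close>

lemma (in group) r_coset_eq_iff:
  assumes "subgroup H G" "x \<in> carrier G" "y \<in> carrier G"
  shows "H #> x = H #> y \<longleftrightarrow> x \<otimes> inv y \<in> H"
  using assms
  by (metis is_group rcos_self repr_independence subgroup.rcos_module)

lemma bij_betw_images:
  assumes "\<And>x y. x \<in> A \<Longrightarrow> y \<in> A \<Longrightarrow> h x = h y \<longleftrightarrow> f x = f y"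
  shows "\<exists>g. bij_betw g (h ` A) (f ` A)"
proof
  have *: "f (inv_into A h (h x)) = f x" if "x \<in> A" for x
    using assms that by (metis f_inv_into_f imageI inv_into_into)
  show "bij_betw (\<lambda>z. f (inv_into A h z)) (h ` A) (f ` A)"
    by (rule bij_betwI') (auto simp: * assms)
qed

text \<open>Any complete invariant of right cosets identifies the coset space with its set of
  values. Every index below is computed by exhibiting such an invariant \<open>f\<close>.\<close>

lemma (in group) rcosets_bij_invariant:
  assumes "subgroup H G"
    and "\<And>x y. x \<in> carrier G \<Longrightarrow> y \<in> carrier G \<Longrightarrow> f x = f y \<longleftrightarrow> x \<otimes> inv y \<in> H"
  shows "\<exists>g. bij_betw g (rcosets H) (f ` carrier G)"
proof -
  have "rcosets H = (\<lambda>x. H #> x) ` carrier G"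
    by (auto simp: RCOSETS_def)
  then show ?thesis
    using bij_betw_images[of "carrier G" "\<lambda>x. H #> x" f] r_coset_eq_iff[OF assms(1)] assms(2)
    by auto
qed

lemma (in group) iso_subgroups_of_index_image:
  assumes "group G'" "h \<in> iso G G'" "H \<in> subgroups_of_index G n"
  shows "h ` H \<in> subgroups_of_index G' n"
proof -
  interpret G': group G' by fact
  interpret h: group_hom G G' h
    using assms(2) by unfold_locales (simp add: iso_def)
  have inj: "inj_on h (carrier G)" and surj: "h ` carrier G = carrier G'"
    using assms(2) by (auto simp: iso_def bij_betw_def)
  have H: "subgroup H G" and fin: "finite (rcosets H)" and card: "card (rcosets H) = n"
    using assms(3) by (auto simp: subgroups_of_index_def)
  have H': "subgroup (h ` H) G'" by (rule h.subgroup_img_is_subgroup[OF H])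
  define f where "f x = h ` H #>\<^bsub>G'\<^esub> h x" for x
  have "f x = f y \<longleftrightarrow> x \<otimes> inv y \<in> H" if "x \<in> carrier G" "y \<in> carrier G" for x y
  proof -
    have "f x = f y \<longleftrightarrow> h (x \<otimes> inv y) \<in> h ` H"
      unfolding f_def using G'.r_coset_eq_iff[OF H'] that by (simp add: h.hom_mult)
    also have "\<dots> \<longleftrightarrow> x \<otimes> inv y \<in> H"
      using inj subgroup.subset[OF H] that by (intro inj_on_image_mem_iff) auto
    finally show ?thesis .
  qed
  then obtain g where "bij_betw g (rcosets H) (f ` carrier G)"
    using rcosets_bij_invariant[OF H] by blast
  moreover have "f ` carrier G = rcosets\<^bsub>G'\<^esub> (h ` H)"
    unfolding f_def[abs_def] RCOSETS_def surj[symmetric] by auto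
  ultimately show ?thesis
    using H' fin card bij_betw_finite bij_betw_same_card
    by (fastforce simp: subgroups_of_index_def)
qed

lemma (in group) iso_subgroups_of_index_bij:
  assumes "group G'" "h \<in> iso G G'"
  shows "bij_betw (image h) (subgroups_of_index G n) (subgroups_of_index G' n)"
proof -
  interpret G': group G' by fact
  let ?k = "inv_into (carrier G) h"
  have inj: "inj_on h (carrier G)" and surj: "h ` carrier G = carrier G'"
    using assms(2) by (auto simp: iso_def bij_betw_def)
  have k: "?k \<in> iso G' G" by (rule iso_set_sym[OF assms(2)])
  show ?thesis
  proof (rule bij_betw_byWitness[where f' = "image ?k"])
    show "\<forall>H\<in>subgroups_of_index G n. ?k ` h ` H = H"
      using inj by (simp add: inv_into_image_cancel subgroups_of_index_subset)
    show "\<forall>H\<in>subgroups_of_index G' n. h ` ?k ` H = H"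
      using surj by (metis image_inv_into_cancel subgroups_of_index_subset)
    show "(`) h ` subgroups_of_index G n \<subseteq> subgroups_of_index G' n"
      using iso_subgroups_of_index_image[OF assms] by blast
    show "(`) ?k ` subgroups_of_index G' n \<subseteq> subgroups_of_index G n"
      using G'.iso_subgroups_of_index_image[OF is_group k] by blast
  qed
qed

text \<open>
  The subgroup with fibre \<open>K\<close> over \<open>0\<close>, projection \<open>d \<int>\<close> and \<open>(c, d)\<close> as an element.
\<close>

definition lift_subgroup ::
    "('a, 'b) monoid_scheme \<Rightarrow> 'a set \<Rightarrow> int \<Rightarrow> 'a \<Rightarrow> ('a \<times> int) set" where
  "lift_subgroup G K d c =
     {(v, t). v \<in> carrier G \<and> d dvd t \<and> v \<otimes>\<^bsub>G\<^esub> inv\<^bsub>G\<^esub> (c [^]\<^bsub>G\<^esub> (t div d)) \<in> K}"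

section \<open>Subgroups of finite index in the product of an abelian group with the
  integers\<close>

lemma DirProd_integer_group: "group G \<Longrightarrow> group (G \<times>\<times> integer_group)"
  by (simp add: DirProd_group)

lemma (in comm_group) pow_quotient_mult:
  assumes "v \<in> carrier G" "w \<in> carrier G" "c \<in> carrier G"
  shows "(v \<otimes> inv (c [^] (i::int))) \<otimes> (w \<otimes> inv (c [^] j)) = (v \<otimes> w) \<otimes> inv (c [^] (i + j))"
  using assms by (simp add: int_pow_mult inv_mult m_ac)

lemma (in comm_group) pow_quotient_inv:
  assumes "v \<in> carrier G" "c \<in> carrier G"
  shows "inv (v \<otimes> inv (c [^] (i::int))) = inv v \<otimes> inv (c [^] (- i))"
  using assms by (simp add: int_pow_neg inv_mult)

text \<open>A coset of the lifted subgroup is determined by the residue of \<open>t\<close> and the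
  \<open>K\<close>-coset left after removing \<open>t div d\<close> copies of \<open>(c, d)\<close>.
  When the residues agree, \<open>(t - s) div d\<close> splits into the difference of the
  quotients.\<close>

lemma (in comm_group) lift_subgroup_quotient_iff:
  assumes "v \<in> carrier G" "w \<in> carrier G" "c \<in> carrier G" "(d::int) > 0"
  shows "(v, t) \<otimes>\<^bsub>G \<times>\<times> integer_group\<^esub> inv\<^bsub>G \<times>\<times> integer_group\<^esub> (w, s) \<in> lift_subgroup G K d c \<longleftrightarrow>
     t mod d = s mod d \<and>
     (v \<otimes> inv (c [^] (t div d))) \<otimes> inv (w \<otimes> inv (c [^] (s div d))) \<in> K"
proof -
  have "(t - s) div d = t div d + - (s div d)" if "d dvd t - s"
  proof -
    have "t mod d = s mod d" using that by (simp add: mod_eq_dvd_iff)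
    then have "t - s = d * (t div d - s div d)"
      by (metis add_diff_cancel_right mult_div_mod_eq right_diff_distrib')
    then show ?thesis using assms by simp
  qed
  then show ?thesis
    using assms
    by (auto simp: lift_subgroup_def inv_DirProd pow_quotient_inv pow_quotient_mult mod_eq_dvd_iff)
qed

lemma (in comm_group) subgroup_lift:
  assumes K: "subgroup K G" and c: "c \<in> carrier G" and d: "d > 0"
  shows "subgroup (lift_subgroup G K d c) (G \<times>\<times> integer_group)"
proof -
  interpret GZ: group "G \<times>\<times> integer_group" by (rule DirProd_integer_group[OF is_group])
  interpret K: subgroup K G by fact
  show ?thesis
  proof (rule GZ.subgroupI)
    show "lift_subgroup G K d c \<subseteq> carrier (G \<times>\<times> integer_group)"
      by (auto simp: lift_subgroup_def)
    have "(\<one>, 0) \<in> lift_subgroup G K d c"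
      using d by (simp add: lift_subgroup_def)
    then show "lift_subgroup G K d c \<noteq> {}" by blast
    show "inv\<^bsub>G \<times>\<times> integer_group\<^esub> x \<in> lift_subgroup G K d c" if x_in: "x \<in> lift_subgroup G K d c" for x
    proof -
      obtain v t where x: "x = (v, t)" "v \<in> carrier G" "d dvd t" "v \<otimes> inv (c [^] (t div d)) \<in> K"
        using x_in by (auto simp: lift_subgroup_def)
      then have "inv v \<otimes> inv (c [^] (- (t div d))) \<in> K"
        using pow_quotient_inv[OF x(2) c] K.m_inv_closed by metis
      then show ?thesis
        using x by (simp add: lift_subgroup_def inv_DirProd dvd_neg_div)
    qed
    show "x \<otimes>\<^bsub>G \<times>\<times> integer_group\<^esub> y \<in> lift_subgroup G K d c"
      if x_in: "x \<in> lift_subgroup G K d c" and y_in: "y \<in> lift_subgroup G K d c" for x y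
    proof -
      obtain v t where x: "x = (v, t)" "v \<in> carrier G" "d dvd t" "v \<otimes> inv (c [^] (t div d)) \<in> K"
        using x_in by (auto simp: lift_subgroup_def)
      obtain w s where y: "y = (w, s)" "w \<in> carrier G" "d dvd s" "w \<otimes> inv (c [^] (s div d)) \<in> K"
        using y_in by (auto simp: lift_subgroup_def)
      have "(v \<otimes> w) \<otimes> inv (c [^] (t div d + s div d)) \<in> K"
        using pow_quotient_mult[OF x(2) y(2) c] K.m_closed[OF x(4) y(4)] by metis
      then show ?thesis
        using x y by (simp add: lift_subgroup_def)
    qed
  qed
qed

text \<open>The invariant is the pair of \<open>K\<close>-coset and residue. All pairs occur,
  because \<open>r div d = 0\<close> for \<open>0 \<le> r < d\<close>, so \<open>(v, r)\<close> has
  value \<open>(K #> v, r)\<close>.\<close>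

lemma (in comm_group) rcosets_lift:
  assumes K: "subgroup K G" and c: "c \<in> carrier G" and d: "d > 0"
  shows "\<exists>g. bij_betw g (rcosets\<^bsub>G \<times>\<times> integer_group\<^esub> (lift_subgroup G K d c)) ((rcosets K) \<times> {0..<d})"
proof -
  interpret GZ: group "G \<times>\<times> integer_group" by (rule DirProd_integer_group[OF is_group])
  interpret K: subgroup K G by fact
  define f where "f = (\<lambda>(v, t). (K #> (v \<otimes> inv (c [^] (t div d))), t mod d))"
  have "f x = f y \<longleftrightarrow>
      x \<otimes>\<^bsub>G \<times>\<times> integer_group\<^esub> inv\<^bsub>G \<times>\<times> integer_group\<^esub> y \<in> lift_subgroup G K d c"
    if xy: "x \<in> carrier (G \<times>\<times> integer_group)" "y \<in> carrier (G \<times>\<times> integer_group)" for x y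
  proof -
    obtain v t w s where "x = (v, t)" "y = (w, s)" "v \<in> carrier G" "w \<in> carrier G"
      using xy by (cases x; cases y) auto
    then show ?thesis
      using lift_subgroup_quotient_iff[OF _ _ c d, of v w t s K] c
      by (auto simp: f_def r_coset_eq_iff[OF K])
  qed
  then obtain g where g:
    "bij_betw g (rcosets\<^bsub>G \<times>\<times> integer_group\<^esub> (lift_subgroup G K d c)) (f ` carrier (G \<times>\<times> integer_group))"
    using GZ.rcosets_bij_invariant[OF subgroup_lift[OF assms]] by blast
  have "f ` carrier (G \<times>\<times> integer_group) = (rcosets K) \<times> {0..<d}"
  proof
    show "f ` carrier (G \<times>\<times> integer_group) \<subseteq> (rcosets K) \<times> {0..<d}"
      using c d by (auto simp: f_def intro!: rcosetsI K.subset)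
    show "(rcosets K) \<times> {0..<d} \<subseteq> f ` carrier (G \<times>\<times> integer_group)"
    proof clarify
      fix C r assume "C \<in> rcosets K" and r: "r \<in> {0..<d}"
      then obtain v where v: "v \<in> carrier G" "C = K #> v" by (auto simp: RCOSETS_def)
      then have "f (v, r) = (C, r)" using r by (simp add: f_def)
      then show "(C, r) \<in> f ` carrier (G \<times>\<times> integer_group)"
        using v by (metis SigmaI UNIV_I carrier_DirProd carrier_integer_group imageI)
    qed
  qed
  then show ?thesis using g by auto
qed

lemma (in comm_group) lift_subgroup_fibre_0:
  assumes "subgroup K G" "d > 0"
  shows "{v. (v, 0) \<in> lift_subgroup G K d c} = K"
  using assms subgroup.mem_carrier[OF assms(1)] by (auto simp: lift_subgroup_def)

lemma (in comm_group) lift_subgroup_fibre_d: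
  assumes "subgroup K G" "c \<in> carrier G" "d > 0"
  shows "{v. (v, d) \<in> lift_subgroup G K d c} = K #> c"
proof -
  have "v \<in> K #> c \<Longrightarrow> v \<in> carrier G" for v
    using assms by (meson is_group subgroup.elemrcos_carrier)
  then show ?thesis
    using assms subgroup.rcos_module[OF assms(1) is_group assms(2)]
    by (auto simp: lift_subgroup_def)
qed

text \<open>Powers of \<open>c\<close> and \<open>c'\<close> differ by powers of
  \<open>c \<otimes> inv c'\<close>, which lie in \<open>K\<close>. Hence only the coset of
  \<open>c\<close> matters.\<close>

lemma (in comm_group) lift_subgroup_cong:
  assumes K: "subgroup K G" and c: "c \<in> carrier G" "c' \<in> carrier G" and eq: "K #> c = K #> c'"
  shows "lift_subgroup G K d c = lift_subgroup G K d c'"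
proof -
  interpret K: subgroup K G by fact
  have "c \<otimes> inv c' \<in> K" using r_coset_eq_iff[OF K c] eq by simp
  then have q: "(c \<otimes> inv c') [^] j \<in> K" for j :: int
    using subgroup_int_pow_closed[OF K] by blast
  have "K #> c [^] j = K #> c' [^] j" for j :: int
    using q[of j] c by (simp add: r_coset_eq_iff[OF K] int_pow_distrib int_pow_inv)
  then show ?thesis
    using c by (auto simp: lift_subgroup_def simp flip: subgroup.rcos_module[OF K is_group])
qed

lemma (in group) DirProd_int_pow:
  assumes "c \<in> carrier G"
  shows "(c, d) [^]\<^bsub>G \<times>\<times> integer_group\<^esub> (q::int) = (c [^] q, q * d)"
proof (rule prod_eqI)
  have GZ: "group (G \<times>\<times> integer_group)" by (rule DirProd_integer_group[OF is_group])
  have "fst \<in> hom (G \<times>\<times> integer_group) G" "snd \<in> hom (G \<times>\<times> integer_group) integer_group"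
    by (auto simp: hom_def mult_DirProd')
  from hom_int_pow[OF this(1) _ GZ is_group, of "(c, d)" q]
    hom_int_pow[OF this(2) _ GZ group_integer_group, of "(c, d)" q]
  show "fst ((c, d) [^]\<^bsub>G \<times>\<times> integer_group\<^esub> q) = fst (c [^] q, q * d)"
    "snd ((c, d) [^]\<^bsub>G \<times>\<times> integer_group\<^esub> q) = snd (c [^] q, q * d)"
    using assms by auto
qed

lemma (in comm_group) finite_index_eq_lift:
  assumes H: "subgroup H (G \<times>\<times> integer_group)"
    and fin: "finite (rcosets\<^bsub>G \<times>\<times> integer_group\<^esub> H)"
  defines "K \<equiv> {v. (v, 0) \<in> H}"
  shows "subgroup K G \<and> (\<exists>d > 0. \<exists>c \<in> carrier G. H = lift_subgroup G K d c)"
proof -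
  let ?Z = "G \<times>\<times> integer_group"
  interpret GZ: group ?Z by (rule DirProd_integer_group[OF is_group])
  interpret H: subgroup H ?Z by fact
  have mult: "(v \<otimes> w, t + s) \<in> H" if "(v, t) \<in> H" "(w, s) \<in> H" for v w t s
    using H.m_closed[OF that] by simp
  have minv: "(inv v, - t) \<in> H" if "(v, t) \<in> H" for v t
    using H.m_inv_closed[OF that] H.mem_carrier[OF that] by (simp add: inv_DirProd)
  have car: "v \<in> carrier G" if "(v, t) \<in> H" for v t
    using H.mem_carrier[OF that] by simp
  have K: "subgroup K G"
  proof (rule subgroupI)
    show "K \<subseteq> carrier G" using car by (auto simp: K_def)
    show "K \<noteq> {}" using H.one_closed by (auto simp: K_def)
    show "inv v \<in> K" if "v \<in> K" for v using minv[of v 0] that by (simp add: K_def)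
    show "v \<otimes> w \<in> K" if "v \<in> K" "w \<in> K" for v w using mult[of v 0 w 0] that by (simp add: K_def)
  qed
  \<comment> \<open>Pigeonhole: the infinitely many elements \<open>(\<one>, int t)\<close> meet
    only finitely many cosets, and two in the same coset yield an element of \<open>H\<close> with
    positive second component.\<close>
  have "\<not> inj_on (\<lambda>t. H #>\<^bsub>?Z\<^esub> (\<one>, int t)) UNIV"
  proof
    assume "inj_on (\<lambda>t. H #>\<^bsub>?Z\<^esub> (\<one>, int t)) UNIV"
    then have "infinite (range (\<lambda>t. H #>\<^bsub>?Z\<^esub> (\<one>, int t)))"
      using finite_imageD infinite_UNIV_nat by blast
    moreover have "range (\<lambda>t. H #>\<^bsub>?Z\<^esub> (\<one>, int t)) \<subseteq> rcosets\<^bsub>?Z\<^esub> H"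
      by (auto intro!: GZ.rcosetsI[OF H.subset])
    ultimately show False using fin finite_subset by blast
  qed
  then obtain s t :: nat where "s < t" "H #>\<^bsub>?Z\<^esub> (\<one>, int t) = H #>\<^bsub>?Z\<^esub> (\<one>, int s)"
    unfolding inj_on_def by (metis linorder_neqE_nat)
  then have "(\<one>, int (t - s)) \<in> H" "t - s > 0"
    using GZ.r_coset_eq_iff[OF H, of "(\<one>, int t)" "(\<one>, int s)"] by (auto simp: inv_DirProd of_nat_diff)
  then have ex: "\<exists>n>0. \<exists>v. (v, int n) \<in> H" by blast
  define n where "n = (LEAST n. n > 0 \<and> (\<exists>v. (v, int n) \<in> H))"
  define d where "d = int n"
  have "n > 0 \<and> (\<exists>v. (v, int n) \<in> H)"
    unfolding n_def by (rule LeastI_ex) (use ex in blast)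
  then obtain c where d: "d > 0" and c: "(c, d) \<in> H" by (auto simp: d_def)
  have cG: "c \<in> carrier G" by (rule car[OF c])
  have pow: "(c [^] q, q * d) \<in> H" for q :: int
    using GZ.subgroup_int_pow_closed[OF H c, of q] DirProd_int_pow[OF cG] by simp
  have "(v, t) \<in> H \<longleftrightarrow> (v, t) \<in> lift_subgroup G K d c" for v t
  proof
    assume vt: "(v, t) \<in> H"
    \<comment> \<open>Division with remainder: removing \<open>t div d\<close> copies of
      \<open>(c, d)\<close> leaves an element of \<open>H\<close> over \<open>t mod d\<close>, and
      minimality of \<open>d\<close> forces this remainder to be zero.\<close>
    have *: "(v \<otimes> inv (c [^] (t div d)), t mod d) \<in> H"
      using mult[OF vt minv[OF pow[of "t div d"]]] by (simp add: minus_div_mult_eq_mod)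
    have "t mod d = 0"
    proof (rule ccontr)
      assume "t mod d \<noteq> 0"
      then have "0 < t mod d" "t mod d < d" using d pos_mod_sign[OF d, of t] pos_mod_bound[OF d, of t] by linarith+
      moreover from this have "int (nat (t mod d)) = t mod d" by simp
      ultimately have "nat (t mod d) > 0 \<and> (\<exists>v. (v, int (nat (t mod d))) \<in> H)" "nat (t mod d) < n"
        using * by (auto simp: d_def)
      then show False unfolding n_def using not_less_Least by blast
    qed
    with * car[OF vt] show "(v, t) \<in> lift_subgroup G K d c"
      by (auto simp: lift_subgroup_def K_def)
  next
    assume "(v, t) \<in> lift_subgroup G K d c"
    then have v: "v \<in> carrier G" "d dvd t" "(v \<otimes> inv (c [^] (t div d)), 0) \<in> H"
      by (auto simp: lift_subgroup_def K_def)
    from mult[OF v(3) pow[of "t div d"]] show "(v, t) \<in> H"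
      using v cG by (simp add: m_assoc)
  qed
  then have "H = lift_subgroup G K d c" by auto
  with K d cG show ?thesis by blast
qed


section \<open>Counting subgroups\<close>

lemma (in group) subgroups_of_index_0 [simp]: "subgroups_of_index G 0 = {}"
proof -
  have "rcosets H \<noteq> {}" if "subgroup H G" for H
    using rcosetsI[OF subgroup.subset[OF that] one_closed] by blast
  then show ?thesis by (auto simp: subgroups_of_index_def card_eq_0_iff)
qed

text \<open>Subgroups of index \<open>n\<close> correspond to pairs of a subgroup \<open>K\<close>
  whose index divides \<open>n\<close> and a coset of \<open>K\<close>. The number \<open>d\<close>
  is not a free parameter, since it equals \<open>n\<close> divided by the index of
  \<open>K\<close>.\<close>

lemma (in comm_group) subgroups_of_index_times_Z:
  assumes n: "n > 0" and fin: "\<And>m. finite (subgroups_of_index G m)"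
  shows "finite (subgroups_of_index (G \<times>\<times> integer_group) n)" (is ?finite)
    and "card (subgroups_of_index (G \<times>\<times> integer_group) n) =
           (\<Sum>m | m dvd n. m * card (subgroups_of_index G m))" (is ?card)
proof -
  let ?Z = "G \<times>\<times> integer_group"
  define fib where "fib H t = {v. (v, t) \<in> H}" for H :: "('a \<times> int) set" and t
  \<comment> \<open>The coset of \<open>c\<close> is recovered as the fibre over \<open>d\<close>;
    writing \<open>d\<close> through the index of the zero fibre makes this a function of
    \<open>H\<close> alone.\<close>
  define \<Psi> where "\<Psi> H = (fib H 0, fib H (int (n div card (rcosets (fib H 0)))))" for H
  define KK where "KK = (\<Union>m\<in>{m. m dvd n}. subgroups_of_index G m)"
  have divs: "finite {m. m dvd n}" using n by simp
  have index_lift: "finite (rcosets\<^bsub>?Z\<^esub> (lift_subgroup G K d c)) \<longleftrightarrow> finite (rcosets K)"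
      "card (rcosets\<^bsub>?Z\<^esub> (lift_subgroup G K d c)) = card (rcosets K) * nat d"
    if "subgroup K G" "c \<in> carrier G" "d > 0" for K d c
  proof -
    obtain g where "bij_betw g (rcosets\<^bsub>?Z\<^esub> (lift_subgroup G K d c)) ((rcosets K) \<times> {0..<d})"
      using rcosets_lift[OF \<open>subgroup K G\<close> \<open>c \<in> carrier G\<close> \<open>d > 0\<close>] by blast
    then show "finite (rcosets\<^bsub>?Z\<^esub> (lift_subgroup G K d c)) \<longleftrightarrow> finite (rcosets K)"
        "card (rcosets\<^bsub>?Z\<^esub> (lift_subgroup G K d c)) = card (rcosets K) * nat d"
      using \<open>d > 0\<close> by (auto simp: bij_betw_finite bij_betw_same_card card_cartesian_product
          finite_cartesian_product_iff)
  qed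
  have decomp: "\<exists>d c. d > 0 \<and> c \<in> carrier G \<and> subgroup (fib H 0) G \<and> finite (rcosets (fib H 0)) \<and>
      card (rcosets (fib H 0)) dvd n \<and> \<Psi> H = (fib H 0, fib H 0 #> c) \<and>
      d = int (n div card (rcosets (fib H 0))) \<and> H = lift_subgroup G (fib H 0) d c"
    if H: "H \<in> subgroups_of_index ?Z n" for H
  proof -
    have *: "subgroup H ?Z" "finite (rcosets\<^bsub>?Z\<^esub> H)" "card (rcosets\<^bsub>?Z\<^esub> H) = n"
      using H by (auto simp: subgroups_of_index_def)
    obtain d c where K: "subgroup (fib H 0) G" and dc: "d > 0" "c \<in> carrier G"
      and eq: "H = lift_subgroup G (fib H 0) d c"
      using finite_index_eq_lift[OF *(1,2)] unfolding fib_def by blast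
    have finK: "finite (rcosets (fib H 0))" and m: "card (rcosets (fib H 0)) * nat d = n"
      using index_lift[OF K dc(2,1)] *(2,3) eq by auto
    then have d: "d = int (n div card (rcosets (fib H 0)))"
      using n dc(1) by auto
    moreover have "fib H d = fib H 0 #> c"
      using lift_subgroup_fibre_d[OF K dc(2,1)] eq unfolding fib_def by auto
    ultimately have "\<Psi> H = (fib H 0, fib H 0 #> c)"
      by (simp add: \<Psi>_def)
    then show ?thesis using K dc eq finK m d by (metis dvd_triv_left)
  qed
  have "bij_betw \<Psi> (subgroups_of_index ?Z n) (SIGMA K:KK. rcosets K)"
  proof (rule bij_betwI')
    fix H H' assume H: "H \<in> subgroups_of_index ?Z n" and H': "H' \<in> subgroups_of_index ?Z n"
    show "\<Psi> H = \<Psi> H' \<longleftrightarrow> H = H'"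
    proof
      assume eq: "\<Psi> H = \<Psi> H'"
      obtain d c where 1: "d > 0" "c \<in> carrier G" "subgroup (fib H 0) G" "\<Psi> H = (fib H 0, fib H 0 #> c)"
        "d = int (n div card (rcosets (fib H 0)))" "H = lift_subgroup G (fib H 0) d c"
        using decomp[OF H] by blast
      obtain d' c' where 2: "c' \<in> carrier G" "\<Psi> H' = (fib H' 0, fib H' 0 #> c')"
        "d' = int (n div card (rcosets (fib H' 0)))" "H' = lift_subgroup G (fib H' 0) d' c'"
        using decomp[OF H'] by blast
      have K: "fib H' 0 = fib H 0" and d: "d' = d" and c: "fib H 0 #> c = fib H 0 #> c'"
        using eq 1 2 by auto
      have "lift_subgroup G (fib H 0) d c = lift_subgroup G (fib H 0) d c'"
        using lift_subgroup_cong[OF 1(3,2) 2(1) c] .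
      then show "H = H'" using 1(6) 2(4) K d by metis
    qed simp
  next
    fix H assume H: "H \<in> subgroups_of_index ?Z n"
    then obtain c where c: "c \<in> carrier G" and K: "subgroup (fib H 0) G"
      "finite (rcosets (fib H 0))" "card (rcosets (fib H 0)) dvd n"
      and \<Psi>: "\<Psi> H = (fib H 0, fib H 0 #> c)"
      using decomp by blast
    have "fib H 0 \<in> KK" using K by (simp add: KK_def subgroups_of_index_def)
    then show "\<Psi> H \<in> (SIGMA K:KK. rcosets K)"
      unfolding \<Psi> using rcosetsI[OF subgroup.subset[OF K(1)] c] by simp
  next
    fix y assume "y \<in> (SIGMA K:KK. rcosets K)"
    then obtain K c where y: "y = (K, K #> c)" and c: "c \<in> carrier G" and K: "subgroup K G"
      and finK: "finite (rcosets K)" and m: "card (rcosets K) dvd n"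
      by (auto simp: KK_def subgroups_of_index_def RCOSETS_def)
    define d where "d = int (n div card (rcosets K))"
    have d: "d > 0" using m n by (auto simp: d_def dvd_div_eq_0_iff)
    let ?H = "lift_subgroup G K d c"
    have "?H \<in> subgroups_of_index ?Z n"
      using index_lift[OF K c d] subgroup_lift[OF K c d] finK m
      by (simp add: subgroups_of_index_def d_def)
    moreover have "\<Psi> ?H = y"
      using lift_subgroup_fibre_0[OF K d] lift_subgroup_fibre_d[OF K c d] y
      by (simp add: \<Psi>_def fib_def flip: d_def)
    ultimately show "\<exists>H\<in>subgroups_of_index ?Z n. y = \<Psi> H" by metis
  qed
  moreover have finKK: "finite KK" using divs fin by (simp add: KK_def)
  moreover have finR: "finite (rcosets K)" if "K \<in> KK" for K
    using that by (auto simp: KK_def subgroups_of_index_def)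
  ultimately show ?finite by (metis bij_betw_finite finite_SigmaI)
  \<comment> \<open>Each \<open>K\<close> contributes its whole coset space, which is the source of
    the factor \<open>m\<close>.\<close>
  have "card (subgroups_of_index ?Z n) = (\<Sum>K\<in>KK. card (rcosets K))"
    using \<open>bij_betw \<Psi> _ _\<close> finKK finR by (simp add: bij_betw_same_card)
  also have "\<dots> = (\<Sum>m | m dvd n. \<Sum>K\<in>subgroups_of_index G m. card (rcosets K))"
    unfolding KK_def
    by (rule sum.UNION_disjoint) (use divs fin in \<open>auto simp: subgroups_of_index_def\<close>)
  also have "\<dots> = (\<Sum>m | m dvd n. m * card (subgroups_of_index G m))"
    by (intro sum.cong refl) (simp add: subgroups_of_index_def)
  finally show ?card .
qed

section \<open>The groups Z^l and the divisor-sum recursion\<close>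

lemma carrier_free_Z: "carrier (free_Z l) = extensional {..<l}"
  by (auto simp: free_Z_def PiE_def)

text \<open>Splits off the last coordinate; updating at \<open>l\<close> inverts the map.
  Extensionality settles the arguments outside the index range, where all values are
  \<open>undefined\<close>.\<close>

lemma free_Z_Suc_iso:
  "(\<lambda>x. (restrict x {..<l}, x l)) \<in> iso (free_Z (Suc l)) (free_Z l \<times>\<times> integer_group)"
proof (rule isoI)
  show "(\<lambda>x. (restrict x {..<l}, x l)) \<in> hom (free_Z (Suc l)) (free_Z l \<times>\<times> integer_group)"
    by (auto simp: hom_def free_Z_def PiE_iff fun_eq_iff)
  show "bij_betw (\<lambda>x. (restrict x {..<l}, x l)) (carrier (free_Z (Suc l)))
          (carrier (free_Z l \<times>\<times> integer_group))"
    unfolding carrier_DirProd carrier_free_Z carrier_integer_group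
  proof (rule bij_betw_byWitness[where f' = "\<lambda>(x, t). x(l := t)"])
    have "(restrict x {..<l})(l := x l) = x" if "x \<in> extensional {..<Suc l}" for x :: "nat \<Rightarrow> int"
    proof
      fix i show "((restrict x {..<l})(l := x l)) i = x i"
        using extensional_arb[OF that, of i] by auto
    qed
    then show "\<forall>x\<in>extensional {..<Suc l}. (\<lambda>(x, t). x(l := t)) (restrict x {..<l}, x l) = (x :: nat \<Rightarrow> int)"
      by simp
    have "restrict (x(l := t)) {..<l} = x" if "x \<in> extensional {..<l}" for x :: "nat \<Rightarrow> int" and t
    proof
      fix i show "restrict (x(l := t)) {..<l} i = x i"
        using extensional_arb[OF that, of i] by auto
    qed
    then show "\<forall>y\<in>extensional {..<l} \<times> UNIV.
        (restrict ((\<lambda>(x, t). x(l := t)) y) {..<l}, (\<lambda>(x, t). x(l := t)) y l) = (y :: (nat \<Rightarrow> int) \<times> int)"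
      by auto
    show "(\<lambda>x. (restrict x {..<l}, x l)) ` extensional {..<Suc l} \<subseteq> extensional {..<l} \<times> (UNIV :: int set)"
      by auto
    show "(\<lambda>(x, t). x(l := t)) ` (extensional {..<l} \<times> (UNIV :: int set)) \<subseteq> extensional {..<Suc l}"
      by (auto simp: extensional_def)
  qed
qed

lemma comm_group_free_Z: "comm_group (free_Z l)"
proof -
  have "group (free_Z l)" by (simp add: free_Z_def)
  then show ?thesis
    by (rule group.group_comm_groupI) (auto simp: free_Z_def)
qed

lemma free_Z_Suc_subgroups_bij:
  "bij_betw (image (\<lambda>x. (restrict x {..<l}, x l))) (subgroups_of_index (free_Z (Suc l)) n)
     (subgroups_of_index (free_Z l \<times>\<times> integer_group) n)"
  using group.iso_subgroups_of_index_bij[OF _ _ free_Z_Suc_iso] DirProd_integer_group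
    comm_group_free_Z comm_group.axioms(2) by blast

lemma finite_subgroups_of_index_free_Z: "finite (subgroups_of_index (free_Z l) n)"
proof (induction l arbitrary: n)
  case 0
  have "subgroups_of_index (free_Z 0) n \<subseteq> Pow {\<lambda>_. undefined}"
    by (auto simp: subgroups_of_index_def free_Z_def dest!: subgroup.subset)
  then show ?case by (rule finite_subset) simp
next
  case (Suc l)
  interpret comm_group "free_Z l" by (rule comm_group_free_Z)
  interpret S: comm_group "free_Z (Suc l)" by (rule comm_group_free_Z)
  show ?case
    using subgroups_of_index_times_Z(1)[OF _ Suc.IH, of n]
      bij_betw_finite[OF free_Z_Suc_subgroups_bij[of l n]]
    \<comment> \<open>The product count requires a positive index; there are no subgroups of index
      \<open>0\<close>.\<close>
    by (cases "n = 0") auto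
qed

lemma num_subgroups_Suc:
  assumes "n > 0"
  shows "num_subgroups (Suc l) n = (\<Sum>m | m dvd n. m * num_subgroups l m)"
proof -
  interpret comm_group "free_Z l" by (rule comm_group_free_Z)
  show ?thesis
    using subgroups_of_index_times_Z(2)[OF assms finite_subgroups_of_index_free_Z]
      bij_betw_same_card[OF free_Z_Suc_subgroups_bij[of l n]]
    by (simp add: num_subgroups_eq)
qed

lemma num_subgroups_0: "num_subgroups 0 n = (if n = 1 then 1 else 0)"
proof -
  interpret comm_group "free_Z 0" by (rule comm_group_free_Z)
  have car: "carrier (free_Z 0) = {\<one>\<^bsub>free_Z 0\<^esub>}"
    by (auto simp: free_Z_def)
  have "subgroup H (free_Z 0) \<longleftrightarrow> H = carrier (free_Z 0)" for H
    using subgroup_self subgroup.subset[of H "free_Z 0"] subgroup.one_closed[of H "free_Z 0"] car by auto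
  moreover have "rcosets\<^bsub>free_Z 0\<^esub> (carrier (free_Z 0)) = {carrier (free_Z 0)}"
    using car by (auto simp: RCOSETS_def r_coset_def)
  ultimately have "subgroups_of_index (free_Z 0) n = (if n = 1 then {carrier (free_Z 0)} else {})"
    by (auto simp: subgroups_of_index_def)
  then show ?thesis by (simp add: num_subgroups_eq)
qed


section \<open>Values of the subgroup counts at 1, ..., 26; the last is needed for
  \<open>P_poly l 26\<close> in \<open>Delta l 25\<close>\<close>

lemma num_subgroups_1: "n > 0 \<Longrightarrow> num_subgroups 1 n = 1"
  using num_subgroups_Suc[of n 0] by (simp add: num_subgroups_0 if_distrib sum.delta cong: if_cong)

lemma num_subgroups_Suc_sum_list:
  assumes "n > 0"
  shows "num_subgroups (Suc l) n = (\<Sum>m\<leftarrow>[1..<Suc n]. if m dvd n then m * num_subgroups l m else 0)"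
proof -
  have "{m. m dvd n} = {m \<in> {1..<Suc n}. m dvd n}"
    using assms by (auto dest: dvd_imp_le intro: Suc_leI dvd_pos_nat)
  then have "num_subgroups (Suc l) n = (\<Sum>m = 1..<Suc n. if m dvd n then m * num_subgroups l m else 0)"
    using num_subgroups_Suc[OF assms, of l] by (simp only: sum.inter_filter finite_atLeastLessThan)
  then show ?thesis
    by (simp only: interv_sum_list_conv_sum_set_nat set_upt)
qed

text \<open>Peeling off \<open>Suc 0\<close> leaves an interval with two numeral bounds, which the
  simplifier can expand.\<close>

lemma upt_1_numeral:
  "[Suc 0..<numeral k] = (if Suc 0 < numeral k then Suc 0 # [2..<numeral k] else [])"
  by (simp add: upt_conv_Cons numeral_2_eq_2)

lemma num_subgroups_2:
  "map (num_subgroups 2) [1..<27] =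
     [1, 3, 4, 7, 6, 12, 8, 15, 13, 18, 12, 28, 14, 24, 24, 31, 18, 39, 20, 42, 32, 36, 24, 60, 31, 42]"
proof -
  \<comment> \<open>Since all positive indices have count 1 for \<open>l = 1\<close>, the counts for
    \<open>l = 2\<close> are the divisor sums.\<close>
  have "num_subgroups 2 n = (\<Sum>m\<leftarrow>[1..<Suc n]. if m dvd n then m else 0)" if "n > 0" for n
  proof -
    have "(\<Sum>m\<leftarrow>[1..<Suc n]. if m dvd n then m * num_subgroups 1 m else 0) =
        (\<Sum>m\<leftarrow>[1..<Suc n]. if m dvd n then m else 0)"
      by (intro arg_cong[where f = sum_list] map_cong refl) (auto simp: num_subgroups_1[simplified])
    then show ?thesis
      using num_subgroups_Suc_sum_list[OF that, of 1] unfolding Suc_1 by metis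
  qed
  then show ?thesis by (simp add: upt_1_numeral)
qed

lemma num_subgroups_3:
  "map (num_subgroups 3) [1..<27] =
     [1, 7, 13, 35, 31, 91, 57, 155, 130, 217, 133, 455, 183, 399, 403, 651, 307, 910, 381, 1085, 741, 931, 553, 2015, 806, 1281]"
proof -
  have "num_subgroups 3 n = (\<Sum>m\<leftarrow>[1..<Suc n]. if m dvd n then m * num_subgroups 2 m else 0)"
    if "n > 0" for n
    using num_subgroups_Suc_sum_list[OF that, of 2] by (simp del: upt_Suc)
  then show ?thesis using num_subgroups_2 by (simp add: upt_1_numeral)
qed

lemma num_subgroups_4:
  "map (num_subgroups 4) [1..<27] =
     [1, 15, 40, 155, 156, 600, 400, 1395, 1210, 2340, 1464, 6200, 2380, 6000, 6240, 11811, 5220, 18150, 7240, 24180, 16000, 21960, 12720, 55800, 20306, 35700]"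
proof -
  have "num_subgroups 4 n = (\<Sum>m\<leftarrow>[1..<Suc n]. if m dvd n then m * num_subgroups 3 m else 0)"
    if "n > 0" for n
    using num_subgroups_Suc_sum_list[OF that, of 3] by (simp del: upt_Suc)
  then show ?thesis using num_subgroups_3 by (simp add: upt_1_numeral)
qed

section \<open>Polynomials as coefficient lists\<close>

fun peval :: "int list \<Rightarrow> real \<Rightarrow> real" where
  "peval [] y = 0"
| "peval (a # as) y = of_int a + y * peval as y"

fun pderiv_eval :: "int list \<Rightarrow> real \<Rightarrow> real" where
  "pderiv_eval [] y = 0"
| "pderiv_eval (a # as) y = peval as y + y * pderiv_eval as y"

fun padd :: "int list \<Rightarrow> int list \<Rightarrow> int list" where
  "padd [] bs = bs"
| "padd as [] = as"
| "padd (a # as) (b # bs) = (a + b) # padd as bs"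

definition psmult :: "int \<Rightarrow> int list \<Rightarrow> int list" where
  "psmult c as = map (\<lambda>a. c * a) as"

lemma peval_padd [simp]: "peval (padd as bs) y = peval as y + peval bs y"
  by (induction as bs rule: padd.induct) (auto simp: algebra_simps)

lemma peval_psmult [simp]: "peval (psmult c as) y = of_int c * peval as y"
  by (induction as) (auto simp: psmult_def algebra_simps)

lemma peval_has_derivative:
  "(peval as has_real_derivative pderiv_eval as y) (at y)"
proof (induction as)
  case (Cons a as)
  then show ?case by (auto intro!: derivative_eq_intros simp: algebra_simps)
qed simp

lemma peval_nonneg:
  assumes "list_all (\<lambda>a. 0 \<le> a) as" "0 \<le> y"
  shows "0 \<le> peval as y"
  using assms(1) by (induction as) (auto simp: assms(2))

text \<open>
  The entry with indices \<open>i, j\<close> contributes \<open>((n + 1) i - n j) a\<^sub>i b\<^sub>j\<close> to the coefficient of \<open>y\<^sup>i\<^sup>+\<^sup>j\<close>,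
  which gives \<open>y ((n + 1) A' B - n A B')\<close> when started with \<open>s = 0\<close>.
\<close>

fun wrow :: "int \<Rightarrow> int \<Rightarrow> int \<Rightarrow> int list \<Rightarrow> int list" where
  "wrow n a s [] = []"
| "wrow n a s (b # bs) = a * (s * b) # wrow n a (s - n) bs"

fun wronskian :: "int \<Rightarrow> int \<Rightarrow> int list \<Rightarrow> int list \<Rightarrow> int list" where
  "wronskian n s [] bs = []"
| "wronskian n s (a # as) bs = padd (wrow n a s bs) (0 # wronskian n (s + n + 1) as bs)"

lemma peval_wrow:
  "peval (wrow n a s bs) y = of_int a * (of_int s * peval bs y - of_int n * (y * pderiv_eval bs y))"
proof (induction bs arbitrary: s)
  case (Cons b bs)
  show ?case by (simp add: Cons.IH) (simp add: algebra_simps)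
qed simp

text \<open>Peeling off \<open>a\<close> lowers the index of each remaining coefficient by one;
  raising \<open>s\<close> by \<open>n + 1\<close> compensates in the weight and the leading
  \<open>0\<close> compensates in the power of \<open>y\<close>.\<close>

lemma peval_wronskian:
  "peval (wronskian n s as bs) y =
     (of_int s * peval as y + of_int (n + 1) * (y * pderiv_eval as y)) * peval bs y
     - of_int n * (peval as y * (y * pderiv_eval bs y))"
proof (induction as arbitrary: s)
  case (Cons a as)
  show ?case by (simp add: Cons.IH peval_wrow) (simp add: algebra_simps)
qed simp

text \<open>The quotient \<open>f\<close> has derivative \<open>(p ^ n / r ^ (n + 1)) * W\<close>,
  with \<open>W\<close> the weighted Wronskian, so the strict inequality at \<open>0\<close>
  propagates. In the application \<open>A\<close> and \<open>B\<close> are the factorials that undo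
  the integer scaling.\<close>

lemma peval_power_gt:
  fixes A B :: real
  assumes w: "list_all (\<lambda>a. 0 \<le> a) (wronskian (int n) 0 as bs)"
    and pos: "\<And>z. 0 \<le> z \<Longrightarrow> 0 < peval as z" "\<And>z. 0 \<le> z \<Longrightarrow> 0 < peval bs z"
    and init: "0 < A" "0 < B" "(peval bs 0 / B) ^ n < (peval as 0 / A) ^ (n + 1)"
    and y: "0 \<le> y"
  shows "(peval bs y / B) ^ n < (peval as y / A) ^ (n + 1)"
proof -
  define f where "f z = peval as z ^ (n + 1) / peval bs z ^ n" for z
  have der: "\<exists>D. (f has_real_derivative D) (at z) \<and> (0 < z \<longrightarrow> 0 \<le> D)" if z: "0 \<le> z" for z
  proof -
    let ?p = "peval as z" and ?r = "peval bs z"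
    let ?p' = "pderiv_eval as z" and ?r' = "pderiv_eval bs z"
    have p: "0 < ?p" and r: "0 < ?r" using pos z by auto
    define W where "W = real (n + 1) * ?p' * ?r - real n * ?p * ?r'"
    have "(f has_real_derivative (?p ^ n / ?r ^ (n + 1)) * W) (at z)"
    proof -
      have "(f has_real_derivative
          ((real (n + 1) * ?p ^ n * ?p') * ?r ^ n - ?p ^ (n + 1) * (real n * ?r ^ (n - 1) * ?r'))
          / (?r ^ n * ?r ^ n)) (at z)"
        unfolding f_def[abs_def]
        using r DERIV_power[OF peval_has_derivative[of as z], of "n + 1"]
          DERIV_power[OF peval_has_derivative[of bs z], of n]
        by (intro DERIV_divide) (simp_all add: mult_ac)
      also have "((real (n + 1) * ?p ^ n * ?p') * ?r ^ n - ?p ^ (n + 1) * (real n * ?r ^ (n - 1) * ?r'))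
          / (?r ^ n * ?r ^ n) = (?p ^ n / ?r ^ (n + 1)) * W"
        \<comment> \<open>At \<open>n = 0\<close> the exponent \<open>n - 1\<close> is truncated,
          but its term has the factor \<open>real n\<close>.\<close>
        using r unfolding W_def by (cases n) (simp_all add: field_simps)
      finally show ?thesis .
    qed
    moreover have "0 \<le> W" if "0 < z"
    proof -
      have "0 \<le> peval (wronskian (int n) 0 as bs) z"
        using peval_nonneg[OF w z] .
      \<comment> \<open>The coefficient list carries an extra factor \<open>z\<close>, so the sign
        of \<open>W\<close> is read off only for \<open>z > 0\<close>; monotonicity on the closed
        interval then uses continuity.\<close>
      also have "\<dots> = z * W"
        by (simp add: peval_wronskian W_def algebra_simps)
      finally show ?thesis using that by (simp add: zero_le_mult_iff)
    qed
    ultimately show ?thesis using p r by (metis divide_nonneg_nonneg less_imp_le mult_nonneg_nonneg zero_less_power)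
  qed
  have "f 0 \<le> f y"
  proof (rule DERIV_nonneg_imp_increasing_open[OF y])
    show "\<exists>D. (f has_real_derivative D) (at z) \<and> 0 \<le> D" if "0 < z" for z
      using der[of z] that by auto
    show "continuous_on {0..y} f"
      using der by (metis DERIV_isCont atLeastAtMost_iff continuous_at_imp_continuous_on)
  qed
  moreover have "A ^ (n + 1) / B ^ n < f 0"
    using init pos(2)[of 0] by (simp add: f_def field_simps power_divide)
  ultimately have "A ^ (n + 1) / B ^ n < f y" by simp
  then show ?thesis
    using init pos(2)[OF y] by (simp add: f_def field_simps power_divide)
qed

section \<open>The polynomials at \<open>1 + y\<close>, scaled to integer coefficients\<close>

text \<open>
  Horner-like evaluation of the sum of \<open>g\<^sub>k (m! / (m + 1 - k)!) Q\<^sub>m\<^sub>+\<^sub>1\<^sub>-\<^sub>k\<close> over \<open>1 \<le> k \<le> m + 1\<close>, where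
  \<open>Q\<^sub>j = j! P\<^sub>j\<close> and the list \<open>qs\<close> is \<open>Q\<^sub>m, \<dots>, Q\<^sub>0\<close>.
\<close>

fun conv_scaled :: "int \<Rightarrow> int list \<Rightarrow> int list list \<Rightarrow> int list" where
  "conv_scaled m (g # gs) (q # qs) = padd (psmult g q) (psmult m (conv_scaled (m - 1) gs qs))"
| "conv_scaled m _ _ = []"

text \<open>The factor \<open>x / (m + 1)\<close> of the recurrence becomes \<open>1 + y\<close>
  after scaling by \<open>(m + 1)!\<close>; prepending \<open>0\<close> multiplies by
  \<open>y\<close>.\<close>

definition next_coeffs :: "int list \<Rightarrow> int \<Rightarrow> int list list \<Rightarrow> int list" where
  "next_coeffs gs m qs = (let c = conv_scaled m gs qs in padd c (0 # c))"


fun const_coeff :: "int list \<Rightarrow> int" where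
  "const_coeff [] = 0"
| "const_coeff (a # as) = a"

lemma peval_0: "peval as 0 = of_int (const_coeff as)"
  by (cases as) auto

lemma peval_pos:
  assumes "list_all (\<lambda>a. 0 \<le> a) as" "0 < const_coeff as" "0 \<le> y"
  shows "0 < peval as y"
  using assms peval_nonneg[of "tl as" y] by (cases as) (auto intro: add_pos_nonneg)

text \<open>Each level multiplies the inner sum by \<open>m\<close>, turning its prefactor
  \<open>(m - 1)!\<close> into \<open>m!\<close>.\<close>

lemma peval_conv_scaled:
  assumes "length qs = Suc m" "Suc m \<le> length gs"
    and "\<And>i. i \<le> m \<Longrightarrow> peval (qs ! i) y = fact (m - i) * p (m - i)"
  shows "peval (conv_scaled (int m) gs qs) y = fact m * (\<Sum>i\<le>m. of_int (gs ! i) * p (m - i))"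
  using assms
proof (induction m arbitrary: gs qs)
  case 0
  then obtain g gs' q where "gs = g # gs'" "qs = [q]"
    by (cases gs; cases qs) auto
  then show ?case using 0(3)[of 0] by simp
next
  case (Suc m)
  then obtain g gs' q qs' where eq: "gs = g # gs'" "qs = q # qs'"
    by (cases gs; cases qs) auto
  have "peval (qs' ! i) y = fact (m - i) * p (m - i)" if "i \<le> m" for i
    using Suc.prems(3)[of "Suc i"] that eq by simp
  then have "peval (conv_scaled (int m) gs' qs') y = fact m * (\<Sum>i\<le>m. of_int (gs' ! i) * p (m - i))"
    using Suc.prems eq by (intro Suc.IH) auto
  moreover have "peval q y = fact (Suc m) * p (Suc m)"
    using Suc.prems(3)[of 0] eq by simp
  ultimately show ?case
    unfolding sum.atMost_Suc_shift by (simp add: eq algebra_simps)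
qed

definition scaled_coeffs :: "nat \<Rightarrow> nat \<Rightarrow> int list list \<Rightarrow> bool" where
  "scaled_coeffs l n qs \<longleftrightarrow> length qs = Suc n \<and>
     (\<forall>i\<le>n. \<forall>y. peval (qs ! i) y = fact (n - i) * P_poly l (n - i) (1 + y))"

lemma peval_next_coeffs:
  assumes qs: "scaled_coeffs l n qs"
    and gs: "Suc n \<le> length gs" "\<And>i. i < length gs \<Longrightarrow> gs ! i = int (num_subgroups l (Suc i))"
  shows "peval (next_coeffs gs (int n) qs) y = fact (Suc n) * P_poly l (Suc n) (1 + y)"
proof -
  have "peval (conv_scaled (int n) gs qs) y =
      fact n * (\<Sum>i\<le>n. of_int (gs ! i) * P_poly l (n - i) (1 + y))"
    using qs gs(1) by (intro peval_conv_scaled) (auto simp: scaled_coeffs_def)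
  also have "(\<Sum>i\<le>n. of_int (gs ! i) * P_poly l (n - i) (1 + y)) =
      (\<Sum>k = 1..Suc n. real (num_subgroups l k) * P_poly l (Suc n - k) (1 + y))"
    unfolding One_nat_def sum.atLeast1_atMost_eq lessThan_Suc_atMost by (intro sum.cong) (use gs in auto)
  finally have "peval (next_coeffs gs (int n) qs) y = (1 + y) * (fact n *
      (\<Sum>k = 1..Suc n. real (num_subgroups l k) * P_poly l (Suc n - k) (1 + y)))"
    by (simp add: next_coeffs_def Let_def algebra_simps)
  then show ?thesis by simp
qed

lemma scaled_coeffs_next:
  assumes "scaled_coeffs l n qs"
    and "Suc n \<le> length gs" "\<And>i. i < length gs \<Longrightarrow> gs ! i = int (num_subgroups l (Suc i))"
  shows "scaled_coeffs l (Suc n) (next_coeffs gs (int n) qs # qs)"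
  unfolding scaled_coeffs_def
proof (intro conjI allI impI)
  show "length (next_coeffs gs (int n) qs # qs) = Suc (Suc n)"
    using assms(1) by (simp add: scaled_coeffs_def)
  show "peval ((next_coeffs gs (int n) qs # qs) ! i) y = fact (Suc n - i) * P_poly l (Suc n - i) (1 + y)"
    if "i \<le> Suc n" for i y
    using that peval_next_coeffs[OF assms, of y] assms(1)
    by (cases i) (auto simp: scaled_coeffs_def simp del: P_poly.simps fact_Suc)
qed

section \<open>Verification\<close>

text \<open>
  For \<open>p = n! P\<^sub>n\<close>, \<open>r = (n + 1)! P\<^sub>n\<^sub>+\<^sub>1\<close> and \<open>f = n!\<close>, the rational \<open>a / 128\<close> lies strictly between the
  roots of \<open>P\<^sub>n(1)\<close> and \<open>P\<^sub>n\<^sub>+\<^sub>1(1)\<close>.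
\<close>

definition separates :: "nat \<Rightarrow> int \<Rightarrow> int \<Rightarrow> int list \<Rightarrow> int list \<Rightarrow> bool" where
  "separates n f a p r \<longleftrightarrow>
     0 < a \<and> 0 < const_coeff p \<and> 0 < const_coeff r \<and>
     list_all (\<lambda>c. 0 \<le> c) p \<and> list_all (\<lambda>c. 0 \<le> c) r \<and>
     f * a ^ n < const_coeff p * 128 ^ n \<and>
     const_coeff r * 128 ^ (n + 1) < f * int (n + 1) * a ^ (n + 1) \<and>
     list_all (\<lambda>c. 0 \<le> c) (wronskian (int n) 0 p r)"

text \<open>At \<open>y = 0\<close> both sides are compared with \<open>c ^ (n * (n + 1))\<close>,
  where \<open>c = a / 128\<close>: one bound is raised to the power \<open>n\<close>, the other to
  \<open>n + 1\<close>. Monotonicity carries the inequality to \<open>y \<ge> 0\<close>.\<close>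

lemma separates_imp_less:
  assumes s: "separates n (fact n) a p r" and y: "0 \<le> y"
  shows "(peval r y / fact (n + 1)) ^ n < (peval p y / fact n) ^ (n + 1)"
proof (rule peval_power_gt)
  show "list_all (\<lambda>a. 0 \<le> a) (wronskian (int n) 0 p r)"
    and "\<And>z. 0 \<le> z \<Longrightarrow> 0 < peval p z" "\<And>z. 0 \<le> z \<Longrightarrow> 0 < peval r z"
    using s by (auto simp: separates_def intro: peval_pos)
  define c where "c = real_of_int a / 128"
  have c: "0 < c" using s by (simp add: c_def separates_def)
  have "real_of_int (fact n * a ^ n) < real_of_int (const_coeff p * 128 ^ n)"
    using s unfolding separates_def of_int_less_iff by blast
  then have p: "c ^ n < peval p 0 / fact n"
    by (simp add: peval_0 c_def field_simps power_divide)
  have "real_of_int (const_coeff r * 128 ^ (n + 1)) < real_of_int (fact n * int (n + 1) * a ^ (n + 1))"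
    using s unfolding separates_def of_int_less_iff by blast
  also have "real_of_int (fact n * int (n + 1) * a ^ (n + 1)) = fact (n + 1) * real_of_int a ^ (n + 1)"
    by simp
  finally have r: "peval r 0 / fact (n + 1) < c ^ (n + 1)"
    by (simp add: peval_0 c_def power_divide pos_divide_less_eq pos_less_divide_eq mult_ac
        del: fact_Suc power_Suc)
  have "0 < peval r 0" using s by (simp add: peval_0 separates_def)
  then have "(peval r 0 / fact (n + 1)) ^ n \<le> (c ^ (n + 1)) ^ n"
    using r by (intro power_mono) auto
  also have "\<dots> = (c ^ n) ^ (n + 1)" by (metis mult.commute power_mult)
  also have "\<dots> < (peval p 0 / fact n) ^ (n + 1)"
    using p c by (intro power_strict_mono) auto
  finally show "(peval r 0 / fact (n + 1)) ^ n < (peval p 0 / fact n) ^ (n + 1)" .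
qed (use y in auto)

text \<open>The list of numerators is consumed along with the recurrence, and \<open>f\<close>
  carries \<open>n!\<close>. An entry \<open>0\<close> skips the test at that index but still
  computes the next polynomial.\<close>

fun verify :: "int list \<Rightarrow> nat \<Rightarrow> int \<Rightarrow> int list list \<Rightarrow> int list \<Rightarrow> bool" where
  "verify gs n f (q # qs) (a # as) =
    (let r = next_coeffs gs (int n) (q # qs)
     in (a = 0 \<or> separates n f a q r) \<and> verify gs (Suc n) (f * int (n + 1)) (r # q # qs) as)"
| "verify gs n f _ _ = True"

lemma verify_sound:
  assumes "verify gs n (fact n) qs as" "scaled_coeffs l n qs"
    and gs: "n + length as \<le> length gs"
      "\<And>i. i < length gs \<Longrightarrow> gs ! i = int (num_subgroups l (Suc i))"
    and "i < length as" "as ! i \<noteq> 0" "1 \<le> x"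
  shows "Delta l (n + i) x > 0"
  using assms(1-3,5,6)
proof (induction as arbitrary: n qs i)
  case (Cons a as)
  obtain q qs' where qs: "qs = q # qs'"
    using Cons.prems(2) by (cases qs) (auto simp: scaled_coeffs_def)
  define r where "r = next_coeffs gs (int n) qs"
  have next_ok: "scaled_coeffs l (Suc n) (r # qs)"
    unfolding r_def using Cons.prems(3) gs(2) by (intro scaled_coeffs_next Cons.prems(2)) auto
  have v: "a = 0 \<or> separates n (fact n) a q r" "verify gs (Suc n) (fact (Suc n)) (r # qs) as"
    using Cons.prems(1) by (auto simp: qs r_def Let_def mult_ac)
  show ?case
  proof (cases i)
    case 0
    with v Cons.prems have "separates n (fact n) a q r" by simp
    from separates_imp_less[OF this, of "x - 1"]
    have "(peval r (x - 1) / fact (n + 1)) ^ n < (peval q (x - 1) / fact n) ^ (n + 1)"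
      using \<open>1 \<le> x\<close> by simp
    moreover have "peval r (x - 1) = fact (n + 1) * P_poly l (n + 1) x"
      using next_ok by (auto simp: scaled_coeffs_def simp del: P_poly.simps fact_Suc
          dest!: spec[of _ 0] spec[of _ "x - 1"])
    moreover have "peval q (x - 1) = fact n * P_poly l n x"
      using Cons.prems(2) qs by (auto simp: scaled_coeffs_def simp del: P_poly.simps fact_Suc
          dest!: spec[of _ 0] spec[of _ "x - 1"])
    ultimately show ?thesis
      by (simp add: Delta_def 0 del: P_poly.simps fact_Suc power_Suc)
  next
    case (Suc j)
    then show ?thesis
      using Cons.IH[OF v(2) next_ok, of j] Cons.prems by simp
  qed
qed simp

section \<open>Numerical certificates for l = 3 and l = 4\<close>

lemma scaled_coeffs_0: "scaled_coeffs l 0 [[1]]"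
  by (simp add: scaled_coeffs_def)

text \<open>The eight zeros skip the indices 0 to 7; the other 18 entries are numerators over 128 of
  separating rationals for the indices 8 to 25.\<close>

lemma verify_3:
  "verify [1, 7, 13, 35, 31, 91, 57, 155, 130, 217, 133, 455, 183, 399, 403, 651, 307, 910, 381, 1085, 741, 931, 553, 2015, 806, 1281]
     0 1 [[1]]
     [0, 0, 0, 0, 0, 0, 0, 0, 264, 263, 260, 259, 256, 255, 253, 251, 249, 248, 246, 245, 243, 242, 241, 239, 238, 237]"
  by code_simp

lemma verify_4:
  "verify [1, 15, 40, 155, 156, 600, 400, 1395, 1210, 2340, 1464, 6200, 2380, 6000, 6240, 11811, 5220, 18150, 7240, 24180, 16000, 21960, 12720, 55800, 20306, 35700]
     0 1 [[1]]
     [0, 0, 0, 0, 0, 0, 0, 0, 370, 368, 364, 361, 358, 355, 352, 349, 346, 344, 341, 339, 337, 335, 332, 330, 328, 327]"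
  by code_simp

lemma Delta_pos_if_verify:
  assumes v: "verify gs 0 1 [[1]] as"
    and gs: "map int (map (num_subgroups l) [1..<27]) = gs"
    and as: "length as = 26" "list_all (\<lambda>a. a \<noteq> 0) (drop 8 as)"
    and n: "8 \<le> n" "n \<le> 25" and x: "1 \<le> x"
  shows "Delta l n x > 0"
proof -
  have gs_nth: "gs ! i = int (num_subgroups l (Suc i))" if "i < length gs" for i
    using that unfolding gs[symmetric] by (simp del: upt_rec_numeral)
  have "as ! n \<noteq> 0"
    \<comment> \<open>Dropping the eight skipped entries shifts position \<open>n\<close> to
      \<open>n - 8\<close>.\<close>
    using as n by (auto simp: list_all_length dest!: spec[of _ "n - 8"])
  moreover have "length gs = 26" unfolding gs[symmetric] by (simp del: upt_rec_numeral)
  ultimately show ?thesis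
    using verify_sound[of gs 0 "[[1]]" as l n x] v as(1) n x gs_nth scaled_coeffs_0 by simp
qed

theorem theorem6p1:
  fixes l n :: nat and x :: real
  assumes "l \<in> {3, 4}" and "8 \<le> n" and "n \<le> 25" and "x \<ge> 1"
  shows "Delta l n x > 0"
proof -
  have n: "8 \<le> n" "n \<le> 25" by fact+
  from assms(1) consider "l = 3" | "l = 4" by auto
  then show ?thesis
  proof cases
    case 1
    show ?thesis
      unfolding 1 by (rule Delta_pos_if_verify[OF verify_3 _ _ _ n \<open>1 \<le> x\<close>]) (subst num_subgroups_3, simp_all)
  next
    case 2
    show ?thesis
      unfolding 2 by (rule Delta_pos_if_verify[OF verify_4 _ _ _ n \<open>1 \<le> x\<close>]) (subst num_subgroups_4, simp_all)
  qed
qed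

end
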